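(* For every bounded operator $W$ on $\mathcal H$ and every automorphism $F$ of $(\mathcal X,\mathcal B,\mu)$, $\|WU_F\|_\mu=\|W\|_\mu$.
   Context: $(\mathcal X,\mathcal B,\mu)$ is a probability measure space and $\mathcal H=L^2(\mathcal X,\mu)$ (complex-valued). For $X\in\mathcal B$, $\pi_X:\mathcal H\to\mathcal H$ is the orthogonal projector $\pi_Xf=\mathbf 1_X f$. A partition is a finite family $\chi=\{Y_1,\dots,Y_J\}\subset\mathcal B$ with $\mu(\mathcal X\setminus\bigcup_j Y_j)=0$ and $\mu(Y_j\cap Y_k)=0$ for $j\ne k$. For a bounded operator $W$ on $\mathcal H$ with operator norm $\|W\|$, put $\mathcal M_\chi(W)=\sum_{j=1}^J\mu(Y_j)\|W\pi_{Y_j}\|^2$, and define the $\mu$-norm $\|W\|_\mu=\inf_\chi\sqrt{\mathcal M_\chi(W)}$, the infimum being over all partitions $\chi$. An automorphism of $(\mathcal X,\mathcal B,\mu)$ is an invertible map $F:\mathcal X\to\mathcal X$ such that $F$ and $F^{-1}$ are measurable and $\mu(F^{-1}(X))=\mu(X)$ for all $X\in\mathcal B$; $U_F$ is the unitary operator on $\mathcal H$ given by $U_Ff=f\circ F$. *)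

theory Defs
  imports "HOL-Probability.Probability"
begin

text \<open>The Hilbert space \<open>L\<^sup>2(M)\<close> depends on the measure \<open>M\<close>, so it is a carrier set
  and not a type: its elements are the classes of square-integrable complex functions modulo
  equality almost everywhere. Values of functions outside \<open>space M\<close> are irrelevant.\<close>

definition square_integrable :: "'a measure \<Rightarrow> ('a \<Rightarrow> complex) set" where
  "square_integrable M =
     {f \<in> borel_measurable M. integrable M (\<lambda>x. (cmod (f x))\<^sup>2)}"

definition ae_rel :: "'a measure \<Rightarrow> (('a \<Rightarrow> complex) \<times> ('a \<Rightarrow> complex)) set" where
  "ae_rel M = {(f, g). f \<in> square_integrable M \<and> g \<in> square_integrable M \<and>
     (AE x in M. f x = g x)}"

abbreviation ae_class :: "'a measure \<Rightarrow> ('a \<Rightarrow> complex) \<Rightarrow> ('a \<Rightarrow> complex) set" where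
  "ae_class M f \<equiv> ae_rel M `` {f}"

definition L2 :: "'a measure \<Rightarrow> ('a \<Rightarrow> complex) set set" where
  "L2 M = square_integrable M // ae_rel M"

text \<open>The operations below are unions (or \<open>the_elem\<close>) over all representatives of a class; the
  lemmas that follow them show that each is computed by any one representative.\<close>

definition L2_add ::
  "'a measure \<Rightarrow> ('a \<Rightarrow> complex) set \<Rightarrow> ('a \<Rightarrow> complex) set \<Rightarrow> ('a \<Rightarrow> complex) set" where
  "L2_add M u v = (\<Union>f\<in>u. \<Union>g\<in>v. ae_class M (\<lambda>x. f x + g x))"

definition L2_scale ::
  "'a measure \<Rightarrow> complex \<Rightarrow> ('a \<Rightarrow> complex) set \<Rightarrow> ('a \<Rightarrow> complex) set" where
  "L2_scale M c u = (\<Union>f\<in>u. ae_class M (\<lambda>x. c * f x))"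

definition L2_norm :: "'a measure \<Rightarrow> ('a \<Rightarrow> complex) set \<Rightarrow> real" where
  "L2_norm M u = the_elem ((\<lambda>f. sqrt (\<integral>x. (cmod (f x))\<^sup>2 \<partial>M)) ` u)"

definition L2_proj ::
  "'a measure \<Rightarrow> 'a set \<Rightarrow> ('a \<Rightarrow> complex) set \<Rightarrow> ('a \<Rightarrow> complex) set" where
  "L2_proj M X u = (\<Union>f\<in>u. ae_class M (\<lambda>x. indicator X x * f x))"

definition koopman ::
  "'a measure \<Rightarrow> ('a \<Rightarrow> 'a) \<Rightarrow> ('a \<Rightarrow> complex) set \<Rightarrow> ('a \<Rightarrow> complex) set" where
  "koopman M F u = (\<Union>f\<in>u. ae_class M (f \<circ> F))"

text \<open>Operators are functions on classes, of which only the restriction to \<open>L2 M\<close> matters.\<close>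

definition bounded_L2_operator ::
  "'a measure \<Rightarrow> (('a \<Rightarrow> complex) set \<Rightarrow> ('a \<Rightarrow> complex) set) \<Rightarrow> bool" where
  "bounded_L2_operator M W \<longleftrightarrow>
     (\<forall>u\<in>L2 M. W u \<in> L2 M) \<and>
     (\<forall>u\<in>L2 M. \<forall>v\<in>L2 M. W (L2_add M u v) = L2_add M (W u) (W v)) \<and>
     (\<forall>c. \<forall>u\<in>L2 M. W (L2_scale M c u) = L2_scale M c (W u)) \<and>
     (\<exists>K. \<forall>u\<in>L2 M. L2_norm M (W u) \<le> K * L2_norm M u)"

definition op_norm ::
  "'a measure \<Rightarrow> (('a \<Rightarrow> complex) set \<Rightarrow> ('a \<Rightarrow> complex) set) \<Rightarrow> real" where
  "op_norm M W = (SUP u\<in>{u \<in> L2 M. L2_norm M u \<le> 1}. L2_norm M (W u))"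

text \<open>A partition is an indexed family \<open>Y 1, \<dots>, Y J\<close>; null and repeated null members are
  allowed.\<close>

definition is_partition :: "'a measure \<Rightarrow> nat \<Rightarrow> (nat \<Rightarrow> 'a set) \<Rightarrow> bool" where
  "is_partition M J Y \<longleftrightarrow>
     (\<forall>j\<in>{1..J}. Y j \<in> sets M) \<and>
     measure M (space M - (\<Union>j\<in>{1..J}. Y j)) = 0 \<and>
     (\<forall>j\<in>{1..J}. \<forall>k\<in>{1..J}. j \<noteq> k \<longrightarrow> measure M (Y j \<inter> Y k) = 0)"

definition partition_sum ::
  "'a measure \<Rightarrow> nat \<Rightarrow> (nat \<Rightarrow> 'a set) \<Rightarrow> (('a \<Rightarrow> complex) set \<Rightarrow> ('a \<Rightarrow> complex) set) \<Rightarrow> real"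
  where
  "partition_sum M J Y W =
     (\<Sum>j=1..J. measure M (Y j) * (op_norm M (W \<circ> L2_proj M (Y j)))\<^sup>2)"

definition mu_norm ::
  "'a measure \<Rightarrow> (('a \<Rightarrow> complex) set \<Rightarrow> ('a \<Rightarrow> complex) set) \<Rightarrow> real" where
  "mu_norm M W = Inf {sqrt (partition_sum M J Y W) | J Y. is_partition M J Y}"

definition measure_automorphism :: "'a measure \<Rightarrow> ('a \<Rightarrow> 'a) \<Rightarrow> bool" where
  "measure_automorphism M F \<longleftrightarrow>
     bij_betw F (space M) (space M) \<and>
     F \<in> measurable M M \<and>
     the_inv_into (space M) F \<in> measurable M M \<and>
     (\<forall>X\<in>sets M. measure M (F -` X \<inter> space M) = measure M X)"

lemma square_integrable_add:
  assumes "f \<in> square_integrable M" "g \<in> square_integrable M"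
  shows "(\<lambda>x. f x + g x) \<in> square_integrable M"
proof -
  have [measurable]: "f \<in> borel_measurable M" "g \<in> borel_measurable M"
    using assms by (auto simp: square_integrable_def)
  have bound: "(cmod (a + b))\<^sup>2 \<le> 2 * (cmod a)\<^sup>2 + 2 * (cmod b)\<^sup>2" for a b :: complex
  proof -
    have "(cmod (a + b))\<^sup>2 \<le> (cmod a + cmod b)\<^sup>2"
      by (intro power_mono norm_triangle_ineq) auto
    also have "\<dots> \<le> 2 * (cmod a)\<^sup>2 + 2 * (cmod b)\<^sup>2"
      using sum_squares_bound[of "cmod a" "cmod b"] by (simp add: power2_sum)
    finally show ?thesis .
  qed
  have "integrable M (\<lambda>x. (cmod (f x + g x))\<^sup>2)"
  proof (rule Bochner_Integration.integrable_bound)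
    show "integrable M (\<lambda>x. 2 * (cmod (f x))\<^sup>2 + 2 * (cmod (g x))\<^sup>2)"
      using assms by (auto simp: square_integrable_def)
  qed (use bound in auto)
  then show ?thesis by (simp add: square_integrable_def)
qed

lemma square_integrable_scale:
  "f \<in> square_integrable M \<Longrightarrow> (\<lambda>x. c * f x) \<in> square_integrable M"
  by (auto simp: square_integrable_def norm_mult power_mult_distrib)

lemma square_integrable_indicator:
  assumes "f \<in> square_integrable M" "X \<in> sets M"
  shows "(\<lambda>x. indicator X x * f x) \<in> square_integrable M"
proof -
  have [measurable]: "f \<in> borel_measurable M" "X \<in> sets M"
    using assms by (auto simp: square_integrable_def)
  have "integrable M (\<lambda>x. (cmod (indicator X x * f x))\<^sup>2)"
    by (rule Bochner_Integration.integrable_bound[of M "\<lambda>x. (cmod (f x))\<^sup>2"])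
      (use assms in \<open>auto simp: square_integrable_def indicator_def\<close>)
  then show ?thesis by (simp add: square_integrable_def)
qed

lemma distr_automorphism:
  assumes "prob_space M" "measure_automorphism M F"
  shows "distr M M F = M"
proof (rule measure_eqI)
  interpret prob_space M by fact
  show "emeasure (distr M M F) X = emeasure M X" if "X \<in> sets (distr M M F)" for X
    using that assms(2)
    by (simp add: measure_automorphism_def emeasure_distr emeasure_eq_measure)
qed simp

lemma square_integrable_comp:
  assumes "prob_space M" "measure_automorphism M F" "f \<in> square_integrable M"
  shows "f \<circ> F \<in> square_integrable M"
proof -
  have F [measurable]: "F \<in> measurable M M" and f [measurable]: "f \<in> borel_measurable M"
    and i: "integrable M (\<lambda>x. (cmod (f x))\<^sup>2)"
    using assms by (auto simp: measure_automorphism_def square_integrable_def)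
  have "integrable (distr M M F) (\<lambda>x. (cmod (f x))\<^sup>2)"
    using i distr_automorphism[OF assms(1,2)] by simp
  then have "integrable M (\<lambda>x. (cmod (f (F x)))\<^sup>2)"
    by (subst (asm) integrable_distr_eq) auto
  then show ?thesis by (simp add: square_integrable_def comp_def)
qed

lemma equiv_ae_rel: "equiv (square_integrable M) (ae_rel M)"
  by (rule equivI) (auto simp: ae_rel_def refl_on_def sym_def intro!: transI)

lemma ae_class_in_L2: "f \<in> square_integrable M \<Longrightarrow> ae_class M f \<in> L2 M"
  by (simp add: L2_def quotientI)

lemma L2_add_class:
  assumes "f \<in> square_integrable M" "g \<in> square_integrable M"
  shows "L2_add M (ae_class M f) (ae_class M g) = ae_class M (\<lambda>x. f x + g x)"
  unfolding L2_add_def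
proof (rule UN_equiv_class2[OF equiv_ae_rel equiv_ae_rel _ assms])
  show "congruent2 (ae_rel M) (ae_rel M) (\<lambda>f g. ae_class M (\<lambda>x. f x + g x))"
    by (rule congruent2I', rule equiv_class_eq[OF equiv_ae_rel])
      (auto simp: ae_rel_def intro: square_integrable_add)
qed

lemma L2_scale_class:
  assumes "f \<in> square_integrable M"
  shows "L2_scale M c (ae_class M f) = ae_class M (\<lambda>x. c * f x)"
  unfolding L2_scale_def
proof (rule UN_equiv_class[OF equiv_ae_rel _ assms])
  show "congruent (ae_rel M) (\<lambda>f. ae_class M (\<lambda>x. c * f x))"
    by (rule congruentI, rule equiv_class_eq[OF equiv_ae_rel])
      (auto simp: ae_rel_def intro: square_integrable_scale)
qed

lemma L2_proj_class:
  assumes "f \<in> square_integrable M" "X \<in> sets M"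
  shows "L2_proj M X (ae_class M f) = ae_class M (\<lambda>x. indicator X x * f x)"
  unfolding L2_proj_def
proof (rule UN_equiv_class[OF equiv_ae_rel _ assms(1)])
  show "congruent (ae_rel M) (\<lambda>f. ae_class M (\<lambda>x. indicator X x * f x))"
    by (rule congruentI, rule equiv_class_eq[OF equiv_ae_rel])
      (use assms(2) in \<open>auto simp: ae_rel_def intro: square_integrable_indicator\<close>)
qed

lemma koopman_class:
  assumes "prob_space M" "measure_automorphism M F" "f \<in> square_integrable M"
  shows "koopman M F (ae_class M f) = ae_class M (f \<circ> F)"
  unfolding koopman_def
proof (rule UN_equiv_class[OF equiv_ae_rel _ assms(3)])
  have F: "F \<in> measurable M M"
    using assms(2) by (simp add: measure_automorphism_def)
  have ae: "AE x in M. f (F x) = g (F x)" if "AE x in M. f x = g x" for f g :: "'a \<Rightarrow> complex"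
    by (rule AE_distrD[OF F]) (simp only: distr_automorphism[OF assms(1,2)] that)
  show "congruent (ae_rel M) (\<lambda>f. ae_class M (f \<circ> F))"
    by (rule congruentI, rule equiv_class_eq[OF equiv_ae_rel])
      (use ae square_integrable_comp[OF assms(1,2)] in \<open>auto simp: ae_rel_def\<close>)
qed

lemma L2_norm_class:
  assumes "f \<in> square_integrable M"
  shows "L2_norm M (ae_class M f) = sqrt (\<integral>x. (cmod (f x))\<^sup>2 \<partial>M)"
proof -
  have "(\<integral>x. (cmod (g x))\<^sup>2 \<partial>M) = (\<integral>x. (cmod (f x))\<^sup>2 \<partial>M)" if "g \<in> ae_class M f" for g
    using that by (intro integral_cong_AE) (auto simp: ae_rel_def square_integrable_def)
  moreover have "f \<in> ae_class M f"
    using assms by (simp add: ae_rel_def)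
  ultimately have "(\<lambda>g. sqrt (\<integral>x. (cmod (g x))\<^sup>2 \<partial>M)) ` ae_class M f
      = (\<lambda>g. sqrt (\<integral>x. (cmod (f x))\<^sup>2 \<partial>M)) ` ae_class M f"
    by (intro image_cong refl) metis
  also have "\<dots> = {sqrt (\<integral>x. (cmod (f x))\<^sup>2 \<partial>M)}"
    using \<open>f \<in> ae_class M f\<close> by blast
  finally show ?thesis by (simp add: L2_norm_def)
qed

end

theory Submission imports Defs begin

text \<open>\<open>U\<^sub>F\<close> permutes the unit ball of \<open>L\<^sup>2\<close> and intertwines the projectors,
  \<open>U\<^sub>F \<pi>\<^sub>Y = \<pi>\<^sub>Z U\<^sub>F\<close> with \<open>Z = F\<^sup>-\<^sup>1(Y)\<close>. Hence \<open>W U\<^sub>F\<close> has at a partition \<open>Y\<close> the same sum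
  as \<open>W\<close> at the partition \<open>F\<^sup>-\<^sup>1(Y)\<close>, and every partition arises as such a preimage.\<close>

lemma L2_E:
  assumes "u \<in> L2 M"
  obtains f where "f \<in> square_integrable M" "u = ae_class M f"
  using assms unfolding L2_def by (rule quotientE)

text \<open>The inverse is used twice below: to show that \<open>koopman M F\<close> maps onto the
  unit ball, and to write a given partition as a preimage.\<close>

lemma measure_automorphism_the_inv_into:
  assumes "measure_automorphism M F"
  shows "measure_automorphism M (the_inv_into (space M) F)" (is "measure_automorphism M ?G")
proof -
  have F: "bij_betw F (space M) (space M)" "F \<in> measurable M M" "?G \<in> measurable M M"
    and pres: "\<And>X. X \<in> sets M \<Longrightarrow> measure M (F -` X \<inter> space M) = measure M X"
    using assms by (auto simp: measure_automorphism_def)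
  have inv: "?G (F x) = x" if "x \<in> space M" for x
    using F(1) that by (auto intro: the_inv_into_f_f bij_betw_imp_inj_on)
  have inv': "F (?G x) = x" if "x \<in> space M" for x
    using F(1) that by (rule f_the_inv_into_f_bij_betw)
  have bij: "bij_betw ?G (space M) (space M)"
    using F(1) by (rule bij_betw_the_inv_into)
  \<comment> \<open>The double inverse is only known to agree with \<open>F\<close> on
    \<open>space M\<close>, which is all that measurability depends on.\<close>
  have "the_inv_into (space M) ?G x = F x" if "x \<in> space M" for x
    using the_inv_into_f_eq[OF bij_betw_imp_inj_on[OF bij] inv] that measurable_space[OF F(2)]
    by simp
  then have meas: "the_inv_into (space M) ?G \<in> measurable M M"
    using F(2) by (subst measurable_cong) auto
  have "measure M (?G -` X \<inter> space M) = measure M X" if X: "X \<in> sets M" for X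
  proof -
    have "F -` (?G -` X \<inter> space M) \<inter> space M = X"
      using sets.sets_into_space[OF X] inv measurable_space[OF F(2)] by auto
    then show ?thesis
      using pres[OF measurable_sets[OF F(3) X]] by simp
  qed
  then show ?thesis
    using bij F(3) meas by (simp add: measure_automorphism_def)
qed

lemma the_inv_into_automorphism:
  assumes "measure_automorphism M F" "x \<in> space M"
  shows "the_inv_into (space M) F (F x) = x"
  using assms
  by (auto simp: measure_automorphism_def intro: the_inv_into_f_f bij_betw_imp_inj_on)

lemma koopman_in_L2:
  assumes "prob_space M" "measure_automorphism M F" "u \<in> L2 M"
  shows "koopman M F u \<in> L2 M"
  using assms by (auto elim!: L2_E simp: koopman_class intro!: ae_class_in_L2 square_integrable_comp)

lemma L2_norm_koopman:
  assumes "prob_space M" "measure_automorphism M F" "u \<in> L2 M"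
  shows "L2_norm M (koopman M F u) = L2_norm M u"
proof -
  obtain f where f: "f \<in> square_integrable M" "u = ae_class M f"
    using assms(3) by (rule L2_E)
  \<comment> \<open>Change of variables: \<open>M\<close> is its own image measure under
    \<open>F\<close>.\<close>
  have "(\<integral>x. (cmod (f x))\<^sup>2 \<partial>M) = (\<integral>x. (cmod (f x))\<^sup>2 \<partial>distr M M F)"
    by (simp add: distr_automorphism[OF assms(1,2)])
  also have "\<dots> = (\<integral>x. (cmod (f (F x)))\<^sup>2 \<partial>M)"
    using assms(2) f(1)
    by (intro integral_distr) (auto simp: measure_automorphism_def square_integrable_def)
  finally show ?thesis
    by (simp add: f koopman_class[OF assms(1,2)] L2_norm_class square_integrable_comp[OF assms(1,2)])
qed

text \<open>A right inverse of \<open>koopman M F\<close>, which yields surjectivity. The functions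
  \<open>f \<circ> ?G \<circ> F\<close> and \<open>f\<close> agree on \<open>space M\<close>, so
  their classes coincide.\<close>

lemma koopman_the_inv_into:
  assumes "prob_space M" "measure_automorphism M F" "u \<in> L2 M"
  shows "koopman M F (koopman M (the_inv_into (space M) F) u) = u"
proof -
  let ?G = "the_inv_into (space M) F"
  obtain f where f: "f \<in> square_integrable M" "u = ae_class M f"
    using assms(3) by (rule L2_E)
  note G = measure_automorphism_the_inv_into[OF assms(2)]
  note fG = square_integrable_comp[OF assms(1) G f(1)]
  have "ae_class M (f \<circ> ?G \<circ> F) = ae_class M f"
    using f(1) square_integrable_comp[OF assms(1,2) fG] the_inv_into_automorphism[OF assms(2)]
    by (intro equiv_class_eq[OF equiv_ae_rel]) (auto simp: ae_rel_def)
  then show ?thesis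
    by (simp add: f koopman_class[OF assms(1) G] koopman_class[OF assms(1,2) fG])
qed

lemma koopman_unit_ball:
  assumes "prob_space M" "measure_automorphism M F"
  shows "koopman M F ` {u \<in> L2 M. L2_norm M u \<le> 1} = {u \<in> L2 M. L2_norm M u \<le> 1}"
    (is "_ ` ?B = ?B")
proof
  show "koopman M F ` ?B \<subseteq> ?B"
    using assms by (auto simp: koopman_in_L2 L2_norm_koopman)
  show "?B \<subseteq> koopman M F ` ?B"
  proof
    fix u assume "u \<in> ?B"
    then show "u \<in> koopman M F ` ?B"
      using assms(1) measure_automorphism_the_inv_into[OF assms(2)]
      by (intro image_eqI[of _ _ "koopman M (the_inv_into (space M) F) u"])
        (auto simp: koopman_the_inv_into[OF assms] koopman_in_L2 L2_norm_koopman)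
  qed
qed

text \<open>On \<open>space M\<close> the indicator of \<open>X\<close> at \<open>F x\<close> is the
  indicator of \<open>?Z\<close> at \<open>x\<close>; both sides therefore have representatives that
  agree there.\<close>

lemma koopman_L2_proj:
  assumes "prob_space M" "measure_automorphism M F" "X \<in> sets M" "u \<in> L2 M"
  shows "koopman M F (L2_proj M X u) = L2_proj M (F -` X \<inter> space M) (koopman M F u)"
proof -
  let ?Z = "F -` X \<inter> space M"
  obtain f where f: "f \<in> square_integrable M" "u = ae_class M f"
    using assms(4) by (rule L2_E)
  have Z: "?Z \<in> sets M"
    using assms(2,3) by (auto simp: measure_automorphism_def)
  note fX = square_integrable_indicator[OF f(1) assms(3)]
  note fF = square_integrable_comp[OF assms(1,2) f(1)]
  have "ae_class M ((\<lambda>x. indicator X x * f x) \<circ> F) = ae_class M (\<lambda>x. indicator ?Z x * (f \<circ> F) x)"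
    using square_integrable_comp[OF assms(1,2) fX] square_integrable_indicator[OF fF Z]
    by (intro equiv_class_eq[OF equiv_ae_rel]) (auto simp: ae_rel_def indicator_def)
  then show ?thesis
    by (simp add: f(2) L2_proj_class[OF f(1) assms(3)] koopman_class[OF assms(1,2) f(1)]
        koopman_class[OF assms(1,2) fX] L2_proj_class[OF fF Z])
qed

text \<open>Moving the projector past \<open>koopman M F\<close> leaves the Koopman operator
  innermost, where it merely reindexes the supremum over the unit ball.\<close>

lemma op_norm_koopman_L2_proj:
  assumes "prob_space M" "measure_automorphism M F" "X \<in> sets M"
  shows "op_norm M (W \<circ> koopman M F \<circ> L2_proj M X) = op_norm M (W \<circ> L2_proj M (F -` X \<inter> space M))"
proof -
  let ?B = "{u \<in> L2 M. L2_norm M u \<le> 1}"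
  let ?g = "\<lambda>u. L2_norm M ((W \<circ> L2_proj M (F -` X \<inter> space M)) u)"
  have "op_norm M (W \<circ> koopman M F \<circ> L2_proj M X) = (SUP u\<in>?B. ?g (koopman M F u))"
    unfolding op_norm_def by (intro SUP_cong refl) (simp add: koopman_L2_proj[OF assms])
  also have "\<dots> = (SUP u\<in>koopman M F ` ?B. ?g u)"
    by (simp only: image_image)
  also have "\<dots> = op_norm M (W \<circ> L2_proj M (F -` X \<inter> space M))"
    by (simp only: koopman_unit_ball[OF assms(1,2)] op_norm_def)
  finally show ?thesis .
qed

lemma partition_sum_koopman:
  assumes "prob_space M" "measure_automorphism M F" "is_partition M J Y"
  shows "partition_sum M J Y (W \<circ> koopman M F) = partition_sum M J (\<lambda>j. F -` Y j \<inter> space M) W"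
  unfolding partition_sum_def using assms
  by (intro sum.cong refl)
    (simp add: op_norm_koopman_L2_proj is_partition_def measure_automorphism_def)

lemma is_partition_vimage:
  assumes "measure_automorphism M F" "is_partition M J Y"
  shows "is_partition M J (\<lambda>j. F -` Y j \<inter> space M)"
proof -
  have F: "F \<in> measurable M M"
    and pres: "\<And>X. X \<in> sets M \<Longrightarrow> measure M (F -` X \<inter> space M) = measure M X"
    using assms(1) by (auto simp: measure_automorphism_def)
  have Y: "\<And>j. j \<in> {1..J} \<Longrightarrow> Y j \<in> sets M"
    using assms(2) by (auto simp: is_partition_def)
  \<comment> \<open>The uncovered part is itself a preimage because \<open>F\<close> maps
    \<open>space M\<close> into itself, so it inherits measure zero.\<close>
  have "space M - (\<Union>j\<in>{1..J}. F -` Y j \<inter> space M)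
      = F -` (space M - (\<Union>j\<in>{1..J}. Y j)) \<inter> space M"
    using measurable_space[OF F] by auto
  moreover have "space M - (\<Union>j\<in>{1..J}. Y j) \<in> sets M"
    using Y by (intro sets.Diff sets.top sets.finite_UN) auto
  moreover have "measure M ((F -` Y j \<inter> space M) \<inter> (F -` Y k \<inter> space M)) = measure M (Y j \<inter> Y k)"
    if "j \<in> {1..J}" "k \<in> {1..J}" for j k
  proof -
    have "(F -` Y j \<inter> space M) \<inter> (F -` Y k \<inter> space M) = F -` (Y j \<inter> Y k) \<inter> space M"
      by auto
    then show ?thesis
      using pres[of "Y j \<inter> Y k"] Y that by simp
  qed
  ultimately show ?thesis
    using assms(2) measurable_sets[OF F] pres unfolding is_partition_def by simp
qed

theorem lemma2p4:
  fixes M :: "'a measure"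
    and W :: "('a \<Rightarrow> complex) set \<Rightarrow> ('a \<Rightarrow> complex) set"
    and F :: "'a \<Rightarrow> 'a"
  assumes "prob_space M"
    and "bounded_L2_operator M W"
    and "measure_automorphism M F"
  shows "mu_norm M (W \<circ> koopman M F) = mu_norm M W"
proof -
  let ?G = "the_inv_into (space M) F"
  let ?S = "\<lambda>W. {sqrt (partition_sum M J Y W) | J Y. is_partition M J Y}"
  \<comment> \<open>The two sets of values are shown to be equal, so their infima need no
    estimate.\<close>
  have "?S (W \<circ> koopman M F) \<subseteq> ?S W"
    using partition_sum_koopman[OF assms(1,3)] is_partition_vimage[OF assms(3)] by fastforce
  moreover have "?S W \<subseteq> ?S (W \<circ> koopman M F)"
  proof clarify
    fix J Y assume Y: "is_partition M J Y"
    \<comment> \<open>For \<open>j\<close> in \<open>{1..J}\<close> this is the image of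
      \<open>Y j\<close> under \<open>F\<close>.\<close>
    let ?Z = "\<lambda>j. ?G -` Y j \<inter> space M"
    have Z: "is_partition M J ?Z"
      using measure_automorphism_the_inv_into[OF assms(3)] Y by (rule is_partition_vimage)
    have F: "F \<in> measurable M M"
      using assms(3) by (simp add: measure_automorphism_def)
    have "F -` ?Z j \<inter> space M = Y j" if "j \<in> {1..J}" for j
    proof -
      have "Y j \<subseteq> space M"
        using Y that by (intro sets.sets_into_space) (auto simp: is_partition_def)
      then show ?thesis
        using the_inv_into_automorphism[OF assms(3)] measurable_space[OF F] by auto
    qed
    \<comment> \<open>The families are known to agree only on \<open>{1..J}\<close>, since
      \<open>Y\<close> is arbitrary at other indices; hence the sums are compared, not the
      families.\<close>
    then have "partition_sum M J (\<lambda>j. F -` ?Z j \<inter> space M) W = partition_sum M J Y W"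
      unfolding partition_sum_def by (intro sum.cong refl) simp
    then have "partition_sum M J ?Z (W \<circ> koopman M F) = partition_sum M J Y W"
      using partition_sum_koopman[OF assms(1,3) Z] by simp
    then show "\<exists>J' Y'. sqrt (partition_sum M J Y W) = sqrt (partition_sum M J' Y' (W \<circ> koopman M F))
        \<and> is_partition M J' Y'"
      using Z by metis
  qed
  ultimately show ?thesis
    unfolding mu_norm_def by (intro arg_cong[of _ _ Inf] subset_antisym)
qed

end
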